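(* Let $A$ be finite-dimensional and $(A,\dashv,\vdash)$ a Novikov dialgebra. If $r\in A\otimes A$ is a symmetric solution of the classical duplicate Novikov Yang-Baxter equation (CDNYBE) in $A$, then $(A,\dashv,\vdash,\delta_r,\Delta_r)$ is a Novikov bi-dialgebra, where for all $a\in A$ $$\Delta_r(a)=\big((L_\dashv-L_\vdash)(a)\otimes\mathrm{id}-\mathrm{id}\otimes(L_\dashv+R_\vdash)(a)\big)r,\qquad \delta_r(a)=\big(\mathrm{id}\otimes L_\star(a)+L_\dashv(a)\otimes\mathrm{id}\big)\tau r.$$
   Context: $\mathbf{k}$ is a field of characteristic zero; vector spaces and tensors are over $\mathbf{k}$; $\tau(a\otimes b)=b\otimes a$, $\tau_{12}=\tau\otimes\mathrm{id}$, $\tau_{23}=\mathrm{id}\otimes\tau$; $r$ is symmetric if $\tau r=r$. Novikov dialgebra $(A,\dashv,\vdash)$: for all $a,b,c$: $(a\vdash b)\dashv c=(a\vdash c)\vdash b=(a\dashv c)\vdash b$; $a\dashv(b\dashv c)=a\dashv(b\vdash c)$; $(a\dashv b)\dashv c=(a\dashv c)\dashv b$; $(a\dashv b)\dashv c-a\dashv(b\dashv c)=(b\vdash a)\dashv c-b\vdash(a\dashv c)$; $(a\vdash b)\vdash c-a\vdash(b\vdash c)=(b\vdash a)\vdash c-b\vdash(a\vdash c)$. Operators: $L_\dashv(a)b=a\dashv b=R_\dashv(b)a$, $L_\vdash(a)b=a\vdash b=R_\vdash(b)a$, $L_\star(a)b=a\star b:=-a\dashv b-b\vdash a+a\vdash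 b+b\dashv a$. CDNYBE: for $r=\sum_ia_i\otimes b_i\in A\otimes A$, $N(r)=0$ where $$N(r)=\sum_{i,j}a_i\vdash a_j\otimes b_i\otimes b_j+a_i\otimes(b_i\vdash a_j-b_i\dashv a_j)\otimes b_j+a_i\otimes a_j\otimes(b_j\vdash b_i+b_i\dashv b_j).$$ Novikov co-dialgebra $(A,\delta,\Delta)$: linear maps $\delta,\Delta:A\to A\otimes A$ with, for all $a$: $(\delta\otimes\mathrm{id})\delta(a)=\tau_{23}(\delta\otimes\mathrm{id})\delta(a)$; $(\Delta\otimes\mathrm{id})\delta(a)=\tau_{23}(\Delta\otimes\mathrm{id})\Delta(a)=\tau_{23}(\delta\otimes\mathrm{id})\Delta(a)$; $(\mathrm{id}\otimes\delta)\delta(a)=(\mathrm{id}\otimes\Delta)\delta(a)$; $(\delta\otimes\mathrm{id}-\mathrm{id}\otimes\delta)\delta(a)=\tau_{12}((\Delta\otimes\mathrm{id})\delta(a)-(\mathrm{id}\otimes\delta)\Delta(a))$; $(\Delta\otimes\mathrm{id}-\mathrm{id}\otimes\Delta)\Delta(a)=\tau_{12}(\Delta\otimes\mathrm{id}-\mathrm{id}\otimes\Delta)\Delta(a)$. Novikov bi-dialgebra $(A,\dashv,\vdash,\delta,\Delta)$: a Novikov dialgebra $(A,\dashv,\vdash)$ and a Novikov co-dialgebra $(A,\delta,\Delta)$ such that for all $a,b\in A$: (1) $(L_\dashv(a)\otimes\mathrm{id})\Delta(b)=-(\mathrm{id}\otimes(L_\dashv+R_\vdash)(b))\delta(a)$;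 (2) $(\mathrm{id}\otimes L_\dashv(b))\delta(a)=(L_\dashv(a)\otimes\mathrm{id})\tau\delta(b)$; (3) $(\mathrm{id}\otimes(L_\dashv+R_\vdash)(a))(\delta(b)+\tau\Delta(b))=(R_\vdash(b)\otimes\mathrm{id})\Delta(a)$; (4) $\delta(a\dashv b)=(R_\dashv(b)\otimes\mathrm{id})\delta(a)+(\mathrm{id}\otimes L_\star(a))(\mathrm{id}-\tau)(\delta(b)-\Delta(b))$; (5) $\delta(a\vdash b)=(R_\vdash(b)\otimes\mathrm{id})(\delta(a)-\Delta(a))+(\mathrm{id}\otimes(L_\vdash+R_\dashv)(a))(\delta(b)+\tau\Delta(b))$; (6) $\Delta(a\dashv b)=(\mathrm{id}\otimes(L_\dashv+R_\vdash)(a))(\mathrm{id}-\tau)(\Delta(b)-\delta(b))+(R_\dashv(b)\otimes\mathrm{id})\Delta(a)$; (7) $\Delta(a\vdash b)=((R_\vdash-R_\dashv)(b)\otimes\mathrm{id})(\delta(a)-\Delta(a))+(\mathrm{id}\otimes(L_\vdash+R_\dashv)(a))(\tau\delta(b)+\Delta(b))$; (8) $((L_\dashv+R_\vdash)(b)\otimes\mathrm{id})(\delta(a)-\Delta(a))+(\mathrm{id}\otimes L_\star(b))\tau(\delta(a)-\Delta(a))-((L_\vdash+R_\dashv)(a)\otimes\mathrm{id})\delta(b)+(\mathrm{id}\otimes(L_\vdash+R_\dashv)(a))\tau\Delta(b)=0$; (9) $(\mathrm{id}\otimes R_\vdash(a))(\mathrm{id}-\tau)(\delta(b)-\Delta(b))-(R_\dashv(b)\otimes\mathrm{id})(\Delta(a)+\tau\delta(a))=-(\mathrm{id}\otimes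 R_\dashv(b))(\Delta(a)+\tau\delta(a))+((R_\vdash-R_\dashv)(a)\otimes\mathrm{id})(\mathrm{id}-\tau)(\Delta(b)-\delta(b))$. *)

theory Defs
  imports Complex_Main "HOL-Library.Poly_Mapping" "HOL-Library.Function_Algebras"
begin

section \<open>Tensors\<close>

text \<open>
  The tensor powers of a vector space \<open>A\<close> are taken as quotients of free vector spaces.
  The finitely supported functions \<open>'b \<Rightarrow>\<^sub>0 'k\<close> form the free vector space
  on \<open>'b\<close>. An element of \<open>A \<otimes> A\<close> is given by a formal sum in
  \<open>'a \<times> 'a \<Rightarrow>\<^sub>0 'k\<close>, an element of \<open>A \<otimes> A \<otimes> A\<close> by one in
  \<open>'a \<times> 'a \<times> 'a \<Rightarrow>\<^sub>0 'k\<close>, and equality of tensors is congruence modulo the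
  subspace spanned by the multilinearity relations (\<open>eq2\<close>, \<open>eq3\<close> below).
\<close>

definition fscale :: "'k::field \<Rightarrow> ('b \<Rightarrow>\<^sub>0 'k) \<Rightarrow> ('b \<Rightarrow>\<^sub>0 'k)"
  where "fscale c t = Poly_Mapping.map ((*) c) t"

lemma lookup_fscale [simp]: "Poly_Mapping.lookup (fscale c t) p = c * Poly_Mapping.lookup t p"
  by (simp add: fscale_def Poly_Mapping.map.rep_eq when_def)

interpretation free: vector_space "fscale :: 'k::field \<Rightarrow> ('b \<Rightarrow>\<^sub>0 'k) \<Rightarrow> _"
  by unfold_locales (rule poly_mapping_eqI; simp add: lookup_add algebra_simps)+

text \<open>The linear extension of a map on the basis of a free vector space.\<close>

definition lext :: "('b \<Rightarrow> 'c \<Rightarrow>\<^sub>0 'k::field) \<Rightarrow> ('b \<Rightarrow>\<^sub>0 'k) \<Rightarrow> ('c \<Rightarrow>\<^sub>0 'k)"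
  where "lext f t = (\<Sum>p\<in>Poly_Mapping.keys t. fscale (Poly_Mapping.lookup t p) (f p))"

abbreviation pure2 :: "'a \<Rightarrow> 'a \<Rightarrow> ('a \<times> 'a \<Rightarrow>\<^sub>0 'k::field)"  ("\<langle>_ \<otimes> _\<rangle>")
  where "\<langle>a \<otimes> b\<rangle> \<equiv> Poly_Mapping.single (a, b) 1"

abbreviation pure3 :: "'a \<Rightarrow> 'a \<Rightarrow> 'a \<Rightarrow> ('a \<times> 'a \<times> 'a \<Rightarrow>\<^sub>0 'k::field)"  ("\<langle>_ \<otimes> _ \<otimes> _\<rangle>")
  where "\<langle>a \<otimes> b \<otimes> c\<rangle> \<equiv> Poly_Mapping.single (a, b, c) 1"

definition rels2 :: "('k::field \<Rightarrow> 'a::ab_group_add \<Rightarrow> 'a) \<Rightarrow> ('a \<times> 'a \<Rightarrow>\<^sub>0 'k) set"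
  where "rels2 scale =
    {\<langle>a + a' \<otimes> b\<rangle> - \<langle>a \<otimes> b\<rangle> - \<langle>a' \<otimes> b\<rangle> | a a' b. True} \<union>
    {\<langle>a \<otimes> b + b'\<rangle> - \<langle>a \<otimes> b\<rangle> - \<langle>a \<otimes> b'\<rangle> | a b b'. True} \<union>
    {\<langle>scale c a \<otimes> b\<rangle> - fscale c \<langle>a \<otimes> b\<rangle> | c a b. True} \<union>
    {\<langle>a \<otimes> scale c b\<rangle> - fscale c \<langle>a \<otimes> b\<rangle> | c a b. True}"

definition rels3 :: "('k::field \<Rightarrow> 'a::ab_group_add \<Rightarrow> 'a) \<Rightarrow> ('a \<times> 'a \<times> 'a \<Rightarrow>\<^sub>0 'k) set"
  where "rels3 scale =
    {\<langle>a + a' \<otimes> b \<otimes> c\<rangle> - \<langle>a \<otimes> b \<otimes> c\<rangle> - \<langle>a' \<otimes> b \<otimes> c\<rangle> | a a' b c. True} \<union>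
    {\<langle>a \<otimes> b + b' \<otimes> c\<rangle> - \<langle>a \<otimes> b \<otimes> c\<rangle> - \<langle>a \<otimes> b' \<otimes> c\<rangle> | a b b' c. True} \<union>
    {\<langle>a \<otimes> b \<otimes> c + c'\<rangle> - \<langle>a \<otimes> b \<otimes> c\<rangle> - \<langle>a \<otimes> b \<otimes> c'\<rangle> | a b c c'. True} \<union>
    {\<langle>scale k a \<otimes> b \<otimes> c\<rangle> - fscale k \<langle>a \<otimes> b \<otimes> c\<rangle> | k a b c. True} \<union>
    {\<langle>a \<otimes> scale k b \<otimes> c\<rangle> - fscale k \<langle>a \<otimes> b \<otimes> c\<rangle> | k a b c. True} \<union>
    {\<langle>a \<otimes> b \<otimes> scale k c\<rangle> - fscale k \<langle>a \<otimes> b \<otimes> c\<rangle> | k a b c. True}"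

definition eq2 ::
    "('k::field \<Rightarrow> 'a::ab_group_add \<Rightarrow> 'a) \<Rightarrow> ('a \<times> 'a \<Rightarrow>\<^sub>0 'k) \<Rightarrow> ('a \<times> 'a \<Rightarrow>\<^sub>0 'k) \<Rightarrow> bool"
  where "eq2 scale s t \<longleftrightarrow> s - t \<in> free.span (rels2 scale)"

definition eq3 ::
    "('k::field \<Rightarrow> 'a::ab_group_add \<Rightarrow> 'a) \<Rightarrow>
      ('a \<times> 'a \<times> 'a \<Rightarrow>\<^sub>0 'k) \<Rightarrow> ('a \<times> 'a \<times> 'a \<Rightarrow>\<^sub>0 'k) \<Rightarrow> bool"
  where "eq3 scale s t \<longleftrightarrow> s - t \<in> free.span (rels3 scale)"

definition tensor_map ::
    "('a \<Rightarrow> 'a) \<Rightarrow> ('a \<Rightarrow> 'a) \<Rightarrow> ('a \<times> 'a \<Rightarrow>\<^sub>0 'k::field) \<Rightarrow> ('a \<times> 'a \<Rightarrow>\<^sub>0 'k)"  (infix "\<otimes>\<^sub>m" 90)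
  where "f \<otimes>\<^sub>m g = lext (\<lambda>(x, y). \<langle>f x \<otimes> g y\<rangle>)"

definition tau :: "('a \<times> 'a \<Rightarrow>\<^sub>0 'k::field) \<Rightarrow> ('a \<times> 'a \<Rightarrow>\<^sub>0 'k)"  ("\<tau>")
  where "\<tau> = lext (\<lambda>(x, y). \<langle>y \<otimes> x\<rangle>)"

definition tau12 :: "('a \<times> 'a \<times> 'a \<Rightarrow>\<^sub>0 'k::field) \<Rightarrow> ('a \<times> 'a \<times> 'a \<Rightarrow>\<^sub>0 'k)"  ("\<tau>\<^sub>1\<^sub>2")
  where "\<tau>\<^sub>1\<^sub>2 = lext (\<lambda>(x, y, z). \<langle>y \<otimes> x \<otimes> z\<rangle>)"

definition tau23 :: "('a \<times> 'a \<times> 'a \<Rightarrow>\<^sub>0 'k::field) \<Rightarrow> ('a \<times> 'a \<times> 'a \<Rightarrow>\<^sub>0 'k)"  ("\<tau>\<^sub>2\<^sub>3")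
  where "\<tau>\<^sub>2\<^sub>3 = lext (\<lambda>(x, y, z). \<langle>x \<otimes> z \<otimes> y\<rangle>)"

text \<open>The maps \<open>\<delta> \<otimes> id\<close> and \<open>id \<otimes> \<delta>\<close> for \<open>\<delta> : A \<rightarrow> A \<otimes> A\<close>.\<close>

definition cop_id ::
    "('a \<Rightarrow> ('a \<times> 'a \<Rightarrow>\<^sub>0 'k::field)) \<Rightarrow> ('a \<times> 'a \<Rightarrow>\<^sub>0 'k) \<Rightarrow> ('a \<times> 'a \<times> 'a \<Rightarrow>\<^sub>0 'k)"
  where "cop_id \<delta> = lext (\<lambda>(x, y). lext (\<lambda>(u, v). \<langle>u \<otimes> v \<otimes> y\<rangle>) (\<delta> x))"

definition id_cop ::
    "('a \<Rightarrow> ('a \<times> 'a \<Rightarrow>\<^sub>0 'k::field)) \<Rightarrow> ('a \<times> 'a \<Rightarrow>\<^sub>0 'k) \<Rightarrow> ('a \<times> 'a \<times> 'a \<Rightarrow>\<^sub>0 'k)"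
  where "id_cop \<delta> = lext (\<lambda>(x, y). lext (\<lambda>(u, v). \<langle>x \<otimes> u \<otimes> v\<rangle>) (\<delta> y))"

subsection \<open>Compatibility with equality of tensors\<close>

lemma lext_single [simp]: "lext f (Poly_Mapping.single p c) = fscale c (f p)"
  by (cases "c = 0") (simp_all add: lext_def lookup_single)

lemma lext_superset:
  assumes "finite K" "Poly_Mapping.keys t \<subseteq> K"
  shows "lext f t = (\<Sum>p\<in>K. fscale (Poly_Mapping.lookup t p) (f p))"
  unfolding lext_def using assms
  by (intro sum.mono_neutral_left) (auto simp: in_keys_iff)

lemma lext_add: "lext f (s + t) = lext f s + lext f t"
proof -
  let ?K = "Poly_Mapping.keys s \<union> Poly_Mapping.keys t"
  have "finite ?K" by simp
  moreover have "Poly_Mapping.keys (s + t) \<subseteq> ?K" by (rule Poly_Mapping.keys_add)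
  ultimately show ?thesis
    by (simp add: lext_superset[of ?K] lookup_add free.scale_left_distrib sum.distrib)
qed

lemma lext_fscale: "lext f (fscale c t) = fscale c (lext f t)"
proof -
  have "Poly_Mapping.keys (fscale c t) \<subseteq> Poly_Mapping.keys t" by (auto simp: in_keys_iff)
  then show ?thesis
    by (simp add: lext_superset[of "Poly_Mapping.keys t"] free.scale_sum_right)
qed

lemma linear_lext: "Vector_Spaces.linear fscale fscale (lext f)"
  by unfold_locales (simp_all add: lext_add lext_fscale)

lemma lext_diff: "lext f (s - t) = lext f s - lext f t"
  by (metis add_diff_cancel_right' diff_add_cancel lext_add)

text \<open>A linear map on formal sums descends to tensors as soon as it respects the multilinearity
  relations.\<close>

lemma eq2_lextI:
  assumes "eq2 scale s t" "free.subspace S" "\<And>u. u \<in> rels2 scale \<Longrightarrow> lext f u \<in> S"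
  shows "lext f s - lext f t \<in> S"
proof -
  have "free.subspace (lext f -` S)"
    using assms(2) unfolding free.subspace_def
    by (auto simp: lext_add lext_fscale) (simp add: lext_def)
  then have "free.span (rels2 scale) \<subseteq> lext f -` S"
    using assms(3) by (intro free.span_minimal) auto
  then show ?thesis
    using assms(1) by (auto simp: eq2_def simp flip: lext_diff)
qed

lemma eq2_tensor_map:
  assumes "Vector_Spaces.linear scale scale f" "Vector_Spaces.linear scale scale g"
    and "eq2 scale s t"
  shows "eq2 scale ((f \<otimes>\<^sub>m g) s) ((f \<otimes>\<^sub>m g) t)"
proof -
  interpret f: Vector_Spaces.linear scale scale f by (fact assms(1))
  interpret g: Vector_Spaces.linear scale scale g by (fact assms(2))
  show ?thesis
    unfolding eq2_def tensor_map_def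
    by (rule eq2_lextI[OF assms(3) free.subspace_span], rule free.span_base)
      (force simp: rels2_def lext_diff lext_fscale f.add g.add f.scale g.scale)
qed

lemma eq2_tau:
  assumes "eq2 scale s t"
  shows "eq2 scale (\<tau> s) (\<tau> t)"
  unfolding eq2_def tau_def
  by (rule eq2_lextI[OF assms free.subspace_span], rule free.span_base)
    (force simp: rels2_def lext_diff lext_fscale)

section \<open>Novikov bi-dialgebras\<close>

locale novikov_dialgebra = vector_space scale
  for scale :: "'k::field_char_0 \<Rightarrow> 'a::ab_group_add \<Rightarrow> 'a" +
  fixes lprod :: "'a \<Rightarrow> 'a \<Rightarrow> 'a"  (infixl "\<stileturn>" 70)
    and rprod :: "'a \<Rightarrow> 'a \<Rightarrow> 'a"  (infixl "\<turnstile>" 70)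
  assumes linear_lprod_left: "Vector_Spaces.linear scale scale (\<lambda>a. a \<stileturn> b)"
    and linear_lprod_right: "Vector_Spaces.linear scale scale (\<lambda>b. a \<stileturn> b)"
    and linear_rprod_left: "Vector_Spaces.linear scale scale (\<lambda>a. a \<turnstile> b)"
    and linear_rprod_right: "Vector_Spaces.linear scale scale (\<lambda>b. a \<turnstile> b)"
    and dialgebra1: "(a \<turnstile> b) \<stileturn> c = (a \<turnstile> c) \<turnstile> b"
    and dialgebra2: "(a \<turnstile> c) \<turnstile> b = (a \<stileturn> c) \<turnstile> b"
    and dialgebra3: "a \<stileturn> (b \<stileturn> c) = a \<stileturn> (b \<turnstile> c)"
    and dialgebra4: "(a \<stileturn> b) \<stileturn> c = (a \<stileturn> c) \<stileturn> b"
    and dialgebra5: "(a \<stileturn> b) \<stileturn> c - a \<stileturn> (b \<stileturn> c) = (b \<turnstile> a) \<stileturn> c - b \<turnstile> (a \<stileturn> c)"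
    and dialgebra6: "(a \<turnstile> b) \<turnstile> c - a \<turnstile> (b \<turnstile> c) = (b \<turnstile> a) \<turnstile> c - b \<turnstile> (a \<turnstile> c)"

locale novikov_codialgebra = vector_space scale
  for scale :: "'k::field_char_0 \<Rightarrow> 'a::ab_group_add \<Rightarrow> 'a" +
  fixes \<delta> \<Delta> :: "'a \<Rightarrow> ('a \<times> 'a \<Rightarrow>\<^sub>0 'k)"
  assumes delta_add: "eq2 scale (\<delta> (a + b)) (\<delta> a + \<delta> b)"
    and delta_scale: "eq2 scale (\<delta> (scale k a)) (fscale k (\<delta> a))"
    and Delta_add: "eq2 scale (\<Delta> (a + b)) (\<Delta> a + \<Delta> b)"
    and Delta_scale: "eq2 scale (\<Delta> (scale k a)) (fscale k (\<Delta> a))"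
    and codialgebra1: "eq3 scale (cop_id \<delta> (\<delta> a)) (\<tau>\<^sub>2\<^sub>3 (cop_id \<delta> (\<delta> a)))"
    and codialgebra2: "eq3 scale (cop_id \<Delta> (\<delta> a)) (\<tau>\<^sub>2\<^sub>3 (cop_id \<Delta> (\<Delta> a)))"
    and codialgebra3: "eq3 scale (\<tau>\<^sub>2\<^sub>3 (cop_id \<Delta> (\<Delta> a))) (\<tau>\<^sub>2\<^sub>3 (cop_id \<delta> (\<Delta> a)))"
    and codialgebra4: "eq3 scale (id_cop \<delta> (\<delta> a)) (id_cop \<Delta> (\<delta> a))"
    and codialgebra5: "eq3 scale ((cop_id \<delta> - id_cop \<delta>) (\<delta> a))
      (\<tau>\<^sub>1\<^sub>2 (cop_id \<Delta> (\<delta> a) - id_cop \<delta> (\<Delta> a)))"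
    and codialgebra6: "eq3 scale ((cop_id \<Delta> - id_cop \<Delta>) (\<Delta> a))
      (\<tau>\<^sub>1\<^sub>2 ((cop_id \<Delta> - id_cop \<Delta>) (\<Delta> a)))"

text \<open>The multiplication operators for a product \<open>p\<close>: \<open>L p a b = p a b = R p b a\<close>.
  Sums and differences such as \<open>(L (\<stileturn>) + R (\<turnstile>)) a\<close> are pointwise.\<close>

definition L :: "('a \<Rightarrow> 'a \<Rightarrow> 'a) \<Rightarrow> 'a \<Rightarrow> 'a \<Rightarrow> 'a"
  where "L p a = (\<lambda>b. p a b)"

definition R :: "('a \<Rightarrow> 'a \<Rightarrow> 'a) \<Rightarrow> 'a \<Rightarrow> 'a \<Rightarrow> 'a"
  where "R p b = (\<lambda>a. p a b)"

context
  fixes lprod :: "'a::ab_group_add \<Rightarrow> 'a \<Rightarrow> 'a"  (infixl "\<stileturn>" 70)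
    and rprod :: "'a \<Rightarrow> 'a \<Rightarrow> 'a"  (infixl "\<turnstile>" 70)
begin

definition star :: "'a \<Rightarrow> 'a \<Rightarrow> 'a"
  where "star a b = - (a \<stileturn> b) - b \<turnstile> a + a \<turnstile> b + b \<stileturn> a"

text \<open>The element \<open>N(r)\<close>; the two nested extensions are the sums over \<open>i\<close> and \<open>j\<close>.\<close>

definition cdnybe :: "('a \<times> 'a \<Rightarrow>\<^sub>0 'k::field) \<Rightarrow> ('a \<times> 'a \<times> 'a \<Rightarrow>\<^sub>0 'k)"
  where "cdnybe r =
    lext (\<lambda>(a\<^sub>i, b\<^sub>i). lext (\<lambda>(a\<^sub>j, b\<^sub>j).
      \<langle>a\<^sub>i \<turnstile> a\<^sub>j \<otimes> b\<^sub>i \<otimes> b\<^sub>j\<rangle>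
      + \<langle>a\<^sub>i \<otimes> b\<^sub>i \<turnstile> a\<^sub>j - b\<^sub>i \<stileturn> a\<^sub>j \<otimes> b\<^sub>j\<rangle>
      + \<langle>a\<^sub>i \<otimes> a\<^sub>j \<otimes> b\<^sub>j \<turnstile> b\<^sub>i + b\<^sub>i \<stileturn> b\<^sub>j\<rangle>) r) r"

definition Delta_of :: "('a \<times> 'a \<Rightarrow>\<^sub>0 'k::field) \<Rightarrow> 'a \<Rightarrow> ('a \<times> 'a \<Rightarrow>\<^sub>0 'k)"
  where "Delta_of r a =
    (((L (\<stileturn>) - L (\<turnstile>)) a \<otimes>\<^sub>m id) - (id \<otimes>\<^sub>m (L (\<stileturn>) + R (\<turnstile>)) a)) r"

definition delta_of :: "('a \<times> 'a \<Rightarrow>\<^sub>0 'k::field) \<Rightarrow> 'a \<Rightarrow> ('a \<times> 'a \<Rightarrow>\<^sub>0 'k)"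
  where "delta_of r a = ((id \<otimes>\<^sub>m L star a) + (L (\<stileturn>) a \<otimes>\<^sub>m id)) (\<tau> r)"

end

locale novikov_bi_dialgebra =
  novikov_dialgebra scale lprod rprod + novikov_codialgebra scale \<delta> \<Delta>
  for scale :: "'k::field_char_0 \<Rightarrow> 'a::ab_group_add \<Rightarrow> 'a"
    and lprod :: "'a \<Rightarrow> 'a \<Rightarrow> 'a"  (infixl "\<stileturn>" 70)
    and rprod :: "'a \<Rightarrow> 'a \<Rightarrow> 'a"  (infixl "\<turnstile>" 70)
    and \<delta> \<Delta> :: "'a \<Rightarrow> ('a \<times> 'a \<Rightarrow>\<^sub>0 'k)" +
  assumes bi1: "eq2 scale
      ((L (\<stileturn>) a \<otimes>\<^sub>m id) (\<Delta> b))
      (- (id \<otimes>\<^sub>m (L (\<stileturn>) + R (\<turnstile>)) b) (\<delta> a))"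
    and bi2: "eq2 scale
      ((id \<otimes>\<^sub>m L (\<stileturn>) b) (\<delta> a))
      ((L (\<stileturn>) a \<otimes>\<^sub>m id) (\<tau> (\<delta> b)))"
    and bi3: "eq2 scale
      ((id \<otimes>\<^sub>m (L (\<stileturn>) + R (\<turnstile>)) a) (\<delta> b + \<tau> (\<Delta> b)))
      ((R (\<turnstile>) b \<otimes>\<^sub>m id) (\<Delta> a))"
    and bi4: "eq2 scale
      (\<delta> (a \<stileturn> b))
      ((R (\<stileturn>) b \<otimes>\<^sub>m id) (\<delta> a)
        + (id \<otimes>\<^sub>m L (star (\<stileturn>) (\<turnstile>)) a) ((id - \<tau>) (\<delta> b - \<Delta> b)))"
    and bi5: "eq2 scale
      (\<delta> (a \<turnstile> b))
      ((R (\<turnstile>) b \<otimes>\<^sub>m id) (\<delta> a - \<Delta> a)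
        + (id \<otimes>\<^sub>m (L (\<turnstile>) + R (\<stileturn>)) a) (\<delta> b + \<tau> (\<Delta> b)))"
    and bi6: "eq2 scale
      (\<Delta> (a \<stileturn> b))
      ((id \<otimes>\<^sub>m (L (\<stileturn>) + R (\<turnstile>)) a) ((id - \<tau>) (\<Delta> b - \<delta> b))
        + (R (\<stileturn>) b \<otimes>\<^sub>m id) (\<Delta> a))"
    and bi7: "eq2 scale
      (\<Delta> (a \<turnstile> b))
      (((R (\<turnstile>) - R (\<stileturn>)) b \<otimes>\<^sub>m id) (\<delta> a - \<Delta> a)
        + (id \<otimes>\<^sub>m (L (\<turnstile>) + R (\<stileturn>)) a) (\<tau> (\<delta> b) + \<Delta> b))"
    and bi8: "eq2 scale
      (((L (\<stileturn>) + R (\<turnstile>)) b \<otimes>\<^sub>m id) (\<delta> a - \<Delta> a)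
        + (id \<otimes>\<^sub>m L (star (\<stileturn>) (\<turnstile>)) b) (\<tau> (\<delta> a - \<Delta> a))
        - ((L (\<turnstile>) + R (\<stileturn>)) a \<otimes>\<^sub>m id) (\<delta> b)
        + (id \<otimes>\<^sub>m (L (\<turnstile>) + R (\<stileturn>)) a) (\<tau> (\<Delta> b)))
      0"
    and bi9: "eq2 scale
      ((id \<otimes>\<^sub>m R (\<turnstile>) a) ((id - \<tau>) (\<delta> b - \<Delta> b))
        - (R (\<stileturn>) b \<otimes>\<^sub>m id) (\<Delta> a + \<tau> (\<delta> a)))
      (- (id \<otimes>\<^sub>m R (\<stileturn>) b) (\<Delta> a + \<tau> (\<delta> a))
        + ((R (\<turnstile>) - R (\<stileturn>)) a \<otimes>\<^sub>m id) ((id - \<tau>) (\<Delta> b - \<delta> b)))"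

end

theory Submission
  imports Defs
begin

text \<open>
  Over a finite-dimensional space a tensor is determined by its values at products of linear
  functionals \<open>f \<otimes> g\<close> or \<open>f \<otimes> g \<otimes> h\<close> (\<open>eq2I\<close>, \<open>eq3I\<close>). So every equation between
  tensors can be read in the dual space \<open>A\<^sup>*\<close>, where a coproduct on \<open>A\<close> is a product. The tensor
  \<open>r\<close> itself becomes the linear map \<open>\<sharp> : A\<^sup>* \<rightarrow> A\<close> with \<open>g (\<sharp> f) = (f \<otimes> g) r\<close>, and symmetry of
  \<open>r\<close> says \<open>g (\<sharp> f) = f (\<sharp> g)\<close>.

  The dual products of \<open>\<delta>\<^sub>r\<close> and \<open>\<Delta>\<^sub>r\<close> are
    \<open>(f \<stileturn>\<^sup>* g) a = g (a \<star> \<sharp> f) + f (a \<stileturn> \<sharp> g)\<close> and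
    \<open>(f \<turnstile>\<^sup>* g) a = f (a \<stileturn> \<sharp> g - a \<turnstile> \<sharp> g) - g (a \<stileturn> \<sharp> f + \<sharp> f \<turnstile> a)\<close>.
  The heart of the proof is that the Yang-Baxter equation makes \<open>\<sharp>\<close> multiplicative,
    \<open>\<sharp> (f \<stileturn>\<^sup>* g) = \<sharp> f \<stileturn> \<sharp> g\<close> and \<open>\<sharp> (f \<turnstile>\<^sup>* g) = \<sharp> f \<turnstile> \<sharp> g\<close>
  (\<open>sharp_dual_lprod\<close>, \<open>sharp_dual_rprod\<close>): \<open>N(r) = 0\<close>, evaluated at \<open>h \<otimes> f \<otimes> g\<close>, is the second
  equation under \<open>h\<close>, and the difference of its values at \<open>f \<otimes> h \<otimes> g\<close> and \<open>h \<otimes> f \<otimes> g\<close> is the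
  first.

  The co-dialgebra axioms say that \<open>A\<^sup>*\<close> with its two products is a Novikov dialgebra. In
  \<open>((f \<stileturn>\<^sup>* g) \<stileturn>\<^sup>* h) a\<close> and its analogues, the dual products occur only under \<open>\<sharp>\<close> or evaluated
  at an element. As \<open>\<sharp>\<close> is multiplicative, such an expression is a sum of values of \<open>f\<close>, \<open>g\<close> and
  \<open>h\<close> at products of three elements of \<open>A\<close>, and the axioms of \<open>A\<close> apply (\<open>dual_dialgebra\<close>).

  The nine compatibility conditions are linear in \<open>r\<close> and follow from its symmetry, by which
  each term can be moved to the form \<open>(f \<circ> u \<otimes> g \<circ> v) r\<close>, where \<open>u\<close> and \<open>v\<close> multiply their
  argument by \<open>a\<close> and \<open>b\<close>; then the axioms of \<open>A\<close>, applied to \<open>u\<close> and \<open>v\<close>, cancel all terms.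
\<close>

section \<open>Evaluating tensors at linear functionals\<close>

definition pairing :: "('b \<Rightarrow> 'k::field) \<Rightarrow> ('b \<Rightarrow>\<^sub>0 'k) \<Rightarrow> 'k"
  where "pairing \<phi> t = (\<Sum>p\<in>Poly_Mapping.keys t. Poly_Mapping.lookup t p * \<phi> p)"

text \<open>Scalars are formal sums over a one-point basis, so linearity is inherited from \<open>lext\<close>.\<close>

lemma pairing_eq_lookup_lext:
  "pairing \<phi> t = Poly_Mapping.lookup (lext (\<lambda>p. Poly_Mapping.single () (\<phi> p)) t) ()"
  by (simp add: pairing_def lext_def lookup_sum)

lemma pairing_single [simp]: "pairing \<phi> (Poly_Mapping.single p c) = c * \<phi> p"
  by (simp add: pairing_eq_lookup_lext)

lemma pairing_add [simp]: "pairing \<phi> (s + t) = pairing \<phi> s + pairing \<phi> t"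
  by (simp add: pairing_eq_lookup_lext lext_add lookup_add)

lemma pairing_diff [simp]: "pairing \<phi> (s - t) = pairing \<phi> s - pairing \<phi> t"
  by (simp add: pairing_eq_lookup_lext lext_diff lookup_minus)

lemma pairing_fscale [simp]: "pairing \<phi> (fscale c t) = c * pairing \<phi> t"
  by (simp add: pairing_eq_lookup_lext lext_fscale)

lemma pairing_zero [simp]: "pairing \<phi> 0 = 0"
  by (simp add: pairing_def)

lemma pairing_uminus [simp]: "pairing \<phi> (- t) = - pairing \<phi> t"
  using pairing_diff[of \<phi> 0 t] by simp

lemma pairing_sum [simp]: "pairing \<phi> (sum t I) = (\<Sum>i\<in>I. pairing \<phi> (t i))"
  by (induction I rule: infinite_finite_induct) simp_all

lemma pairing_lext [simp]: "pairing \<phi> (lext m t) = pairing (\<lambda>p. pairing \<phi> (m p)) t"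
  by (simp add: lext_def pairing_def[of "\<lambda>p. pairing \<phi> (m p)"])

lemma pairing_fun_add: "pairing (\<lambda>p. \<phi> p + \<psi> p) t = pairing \<phi> t + pairing \<psi> t"
  by (simp add: pairing_def algebra_simps sum.distrib)

lemma pairing_fun_diff: "pairing (\<lambda>p. \<phi> p - \<psi> p) t = pairing \<phi> t - pairing \<psi> t"
  by (simp add: pairing_def algebra_simps sum_subtractf)

lemma pairing_fun_mult: "pairing (\<lambda>p. c * \<phi> p) t = c * pairing \<phi> t"
  by (simp add: pairing_def sum_distrib_left mult_ac)

lemma pairing_fun_mult_right: "pairing (\<lambda>p. \<phi> p * c) t = pairing \<phi> t * c"
  by (simp add: pairing_fun_mult mult.commute[of _ c])

definition eval2 :: "('a \<Rightarrow> 'k::field) \<Rightarrow> ('a \<Rightarrow> 'k) \<Rightarrow> ('a \<times> 'a \<Rightarrow>\<^sub>0 'k) \<Rightarrow> 'k"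
  where "eval2 f g = pairing (\<lambda>(x, y). f x * g y)"

definition eval3 ::
    "('a \<Rightarrow> 'k::field) \<Rightarrow> ('a \<Rightarrow> 'k) \<Rightarrow> ('a \<Rightarrow> 'k) \<Rightarrow> ('a \<times> 'a \<times> 'a \<Rightarrow>\<^sub>0 'k) \<Rightarrow> 'k"
  where "eval3 f g h = pairing (\<lambda>(x, y, z). f x * g y * h z)"

lemma eval2_simps [simp]:
  "eval2 f g (s + t) = eval2 f g s + eval2 f g t"
  "eval2 f g (s - t) = eval2 f g s - eval2 f g t"
  "eval2 f g (- t) = - eval2 f g t"
  "eval2 f g 0 = 0"
  "eval2 f g (fscale c t) = c * eval2 f g t"
  by (simp_all add: eval2_def)

lemma eval3_simps [simp]:
  "eval3 f g h (s + t) = eval3 f g h s + eval3 f g h t"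
  "eval3 f g h (s - t) = eval3 f g h s - eval3 f g h t"
  "eval3 f g h 0 = 0"
  by (simp_all add: eval3_def)

lemma eval2_tensor_map: "eval2 f g ((F \<otimes>\<^sub>m G) t) = eval2 (\<lambda>x. f (F x)) (\<lambda>x. g (G x)) t"
  by (simp add: eval2_def tensor_map_def case_prod_unfold)

lemma eval2_tau: "eval2 f g (\<tau> t) = eval2 g f t"
  by (simp add: eval2_def tau_def case_prod_unfold mult.commute)

lemma eval3_tau12: "eval3 f g h (\<tau>\<^sub>1\<^sub>2 t) = eval3 g f h t"
  by (simp add: eval3_def tau12_def case_prod_unfold mult_ac)

lemma eval3_tau23: "eval3 f g h (\<tau>\<^sub>2\<^sub>3 t) = eval3 f h g t"
  by (simp add: eval3_def tau23_def case_prod_unfold mult_ac)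

text \<open>
  Under a functional on the first two factors, the map \<open>c \<otimes> id\<close> becomes a change of the functional on
  its argument: an iterated coproduct becomes an iterated product of functionals.
\<close>

lemma eval3_cop_id: "eval3 f g h (cop_id c t) = eval2 (\<lambda>x. eval2 f g (c x)) h t"
  by (simp add: eval3_def eval2_def cop_id_def case_prod_unfold pairing_fun_mult flip: mult.commute[of "h _"])

lemma eval3_id_cop: "eval3 f g h (id_cop c t) = eval2 f (\<lambda>x. eval2 g h (c x)) t"
  by (simp add: eval3_def eval2_def id_cop_def case_prod_unfold pairing_fun_mult mult.assoc)

lemma eval2_fun_simps:
  "eval2 (\<lambda>x. 0) g t = 0"
  "eval2 f (\<lambda>x. 0) t = 0"
  "eval2 (\<lambda>x. f x + f' x) g t = eval2 f g t + eval2 f' g t"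
  "eval2 (\<lambda>x. f x - f' x) g t = eval2 f g t - eval2 f' g t"
  "eval2 (\<lambda>x. - f x) g t = - eval2 f g t"
  "eval2 f (\<lambda>x. g x + g' x) t = eval2 f g t + eval2 f g' t"
  "eval2 f (\<lambda>x. g x - g' x) t = eval2 f g t - eval2 f g' t"
  "eval2 f (\<lambda>x. - g x) t = - eval2 f g t"
  using pairing_fun_mult[of "-1"] pairing_fun_mult[of 0]
  by (simp_all add: eval2_def case_prod_unfold algebra_simps pairing_fun_add pairing_fun_diff)

section \<open>Functionals separate tensors\<close>

abbreviation functional :: "('k::field \<Rightarrow> 'a::ab_group_add \<Rightarrow> 'a) \<Rightarrow> ('a \<Rightarrow> 'k) \<Rightarrow> bool"
  where "functional scale \<equiv> Vector_Spaces.linear scale (*)"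

lemma functionalI:
  assumes "vector_space scale" "\<And>x y. f (x + y) = f x + f y" "\<And>c x. f (scale c x) = c * f x"
  shows "functional scale f"
  using assms by (simp add: Vector_Spaces.linear_iff vector_space_def algebra_simps)

lemma functional_simps:
  assumes "functional scale f"
  shows "f 0 = 0" "f (x + y) = f x + f y" "f (x - y) = f x - f y" "f (- x) = - f x"
    "f (scale c x) = c * f x" "f (sum u I) = (\<Sum>i\<in>I. f (u i))"
proof -
  interpret Vector_Spaces.linear scale "(*)" f by (fact assms)
  show "f 0 = 0" "f (x + y) = f x + f y" "f (x - y) = f x - f y" "f (- x) = - f x"
    "f (scale c x) = c * f x" "f (sum u I) = (\<Sum>i\<in>I. f (u i))"
    by (rule zero add diff neg scale sum)+
qed

lemma pairing_span_eq_0: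
  assumes "\<And>u. u \<in> U \<Longrightarrow> pairing \<phi> u = 0" "t \<in> free.span U"
  shows "pairing \<phi> t = 0"
proof -
  have "free.span U \<subseteq> {t. pairing \<phi> t = 0}"
    using assms(1) by (intro free.span_minimal) (auto simp: free.subspace_def)
  with assms(2) show ?thesis by blast
qed

lemma eval2_eq:
  assumes "functional scale f" "functional scale g" "eq2 scale s t"
  shows "eval2 f g s = eval2 f g t"
proof -
  have "eval2 f g (s - t) = 0"
    using assms(3) unfolding eq2_def eval2_def
    by (rule pairing_span_eq_0[rotated])
      (auto simp: rels2_def functional_simps[OF assms(1)] functional_simps[OF assms(2)] distrib_left distrib_right)
  then show ?thesis by simp
qed

lemma eval3_eq:
  assumes "functional scale f" "functional scale g" "functional scale h" "eq3 scale s t"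
  shows "eval3 f g h s = eval3 f g h t"
proof -
  have "eval3 f g h (s - t) = 0"
    using assms(4) unfolding eq3_def eval3_def
    by (rule pairing_span_eq_0[rotated])
      (auto simp: rels3_def functional_simps[OF assms(1)] functional_simps[OF assms(2)]
        functional_simps[OF assms(3)] distrib_left distrib_right)
  then show ?thesis by simp
qed

text \<open>
  Both separation theorems have this form: modulo the relations \<open>S\<close>, each generator is a combination
  of finitely many tensors \<open>w i\<close> with coefficients \<open>\<phi> i p\<close>. By linearity \<open>t\<close> is then
  congruent to the combination of the \<open>w i\<close> with coefficients \<open>pairing (\<phi> i) t\<close>.
\<close>

lemma mem_subspace_if_pairings_eq_0:
  assumes S: "free.subspace S"
    and expand: "\<And>p. Poly_Mapping.single p 1 - (\<Sum>i\<in>I. fscale (\<phi> i p) (w i)) \<in> S"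
    and eq_0: "\<And>i. i \<in> I \<Longrightarrow> pairing (\<phi> i) t = 0"
  shows "t \<in> S"
proof -
  let ?c = "Poly_Mapping.lookup t" and ?K = "Poly_Mapping.keys t"
  have "(\<Sum>p\<in>?K. fscale (?c p) (Poly_Mapping.single p 1 - (\<Sum>i\<in>I. fscale (\<phi> i p) (w i)))) \<in> S"
    by (intro free.subspace_sum[OF S] free.subspace_scale[OF S] expand)
  moreover have "(\<Sum>p\<in>?K. fscale (?c p) (\<Sum>i\<in>I. fscale (\<phi> i p) (w i)))
      = (\<Sum>i\<in>I. \<Sum>p\<in>?K. fscale (?c p * \<phi> i p) (w i))"
    by (simp add: free.scale_sum_right sum.swap[of _ I])
  moreover have "\<dots> = (\<Sum>i\<in>I. fscale (pairing (\<phi> i) t) (w i))"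
    by (simp add: pairing_def free.scale_sum_left)
  moreover have "(\<Sum>p\<in>?K. fscale (?c p) (Poly_Mapping.single p 1)) = t"
    by (rule poly_mapping_eqI)
      (simp add: lookup_sum lookup_single when_def in_keys_iff if_distrib sum.delta cong: if_cong)
  ultimately show ?thesis
    by (simp add: free.scale_right_diff_distrib sum_subtractf eq_0)
qed

lemma rels3_intros:
  "\<langle>a + a' \<otimes> b \<otimes> c\<rangle> - \<langle>a \<otimes> b \<otimes> c\<rangle> - \<langle>a' \<otimes> b \<otimes> c\<rangle> \<in> rels3 scale"
  "\<langle>a \<otimes> b + b' \<otimes> c\<rangle> - \<langle>a \<otimes> b \<otimes> c\<rangle> - \<langle>a \<otimes> b' \<otimes> c\<rangle> \<in> rels3 scale"
  "\<langle>a \<otimes> b \<otimes> c + c'\<rangle> - \<langle>a \<otimes> b \<otimes> c\<rangle> - \<langle>a \<otimes> b \<otimes> c'\<rangle> \<in> rels3 scale"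
  "\<langle>scale k a \<otimes> b \<otimes> c\<rangle> - fscale k \<langle>a \<otimes> b \<otimes> c\<rangle> \<in> rels3 scale"
  "\<langle>a \<otimes> scale k b \<otimes> c\<rangle> - fscale k \<langle>a \<otimes> b \<otimes> c\<rangle> \<in> rels3 scale"
  "\<langle>a \<otimes> b \<otimes> scale k c\<rangle> - fscale k \<langle>a \<otimes> b \<otimes> c\<rangle> \<in> rels3 scale"
  unfolding rels3_def
  \<comment> \<open>The union is nested to the left: \<open>UnI1\<close> discards the last family until the right one is last.\<close>
  by (((rule UnI2)?, intro CollectI exI conjI, rule refl, rule TrueI) | rule UnI1)+

context finite_dimensional_vector_space
begin

abbreviation coord :: "'b \<Rightarrow> 'b \<Rightarrow> 'a"
  where "coord b x \<equiv> representation Basis x b"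

lemma functional_coord: "functional scale (coord b)"
  by (intro functionalI vector_space_axioms)
    (simp_all add: representation_add representation_scale independent_Basis span_Basis)

lemma sum_coord: "(\<Sum>b\<in>Basis. coord b x *s b) = x"
  using sum_representation_eq[OF independent_Basis _ finite_Basis subset_refl, of x]
  by (simp add: span_Basis)

lemma functionals_separate_points:
  assumes "\<And>f. functional scale f \<Longrightarrow> f x = f y"
  shows "x = y"
proof -
  have "coord b x = coord b y" for b by (rule assms[OF functional_coord])
  then have "(\<Sum>b\<in>Basis. coord b x *s b) = (\<Sum>b\<in>Basis. coord b y *s b)" by (simp only:)
  then show ?thesis by (simp only: sum_coord)
qed

text \<open>
  A map \<open>q\<close> that is linear modulo \<open>S\<close>, such as \<open>\<lambda>x. \<langle>x \<otimes> y\<rangle>\<close> modulo the multilinearity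
  relations, is determined modulo \<open>S\<close> by its values on the basis.
\<close>

lemma expand_in_basis:
  fixes q :: "'b \<Rightarrow> ('c \<Rightarrow>\<^sub>0 'a)"
  assumes S: "free.subspace S"
    and add: "\<And>x y. q (x + y) - q x - q y \<in> S"
    and scale: "\<And>c x. q (c *s x) - fscale c (q x) \<in> S"
  shows "q x - (\<Sum>b\<in>Basis. fscale (coord b x) (q b)) \<in> S"
proof -
  have "q (\<Sum>b\<in>K. c b *s b) - (\<Sum>b\<in>K. fscale (c b) (q b)) \<in> S" if "finite K" for K and c
    using that
  proof (induction K rule: finite_induct)
    case empty
    show ?case using scale[of 0 0] by simp
  next
    case (insert b K)
    from free.subspace_add[OF S free.subspace_add[OF S
          add[of "c b *s b" "\<Sum>b\<in>K. c b *s b"] scale[of "c b" b]] insert.IH]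
    show ?case using insert.hyps by (simp add: diff_diff_eq)
  qed
  from this[OF finite_Basis, of "\<lambda>b. coord b x"] show ?thesis
    by (simp add: sum_coord)
qed

lemma eq2I:
  assumes "\<And>f g. functional scale f \<Longrightarrow> functional scale g \<Longrightarrow> eval2 f g s = eval2 f g t"
  shows "eq2 scale s t"
  unfolding eq2_def
proof (rule mem_subspace_if_pairings_eq_0[OF free.subspace_span])
  let ?S = "free.span (rels2 scale)"
  note S = free.subspace_span[of "rels2 scale"]
  fix p :: "'b \<times> 'b"
  obtain x y where p: "p = (x, y)" by (cases p)
  have 1: "\<langle>x \<otimes> y\<rangle> - (\<Sum>b\<in>Basis. fscale (coord b x) \<langle>b \<otimes> y\<rangle>) \<in> ?S" for x y
    by (rule expand_in_basis[OF S]; rule free.span_base, unfold rels2_def) blast+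
  have 2: "\<langle>x \<otimes> y\<rangle> - (\<Sum>b\<in>Basis. fscale (coord b y) \<langle>x \<otimes> b\<rangle>) \<in> ?S" for x y
    by (rule expand_in_basis[OF S]; rule free.span_base, unfold rels2_def) blast+
  have "(\<Sum>b\<in>Basis. fscale (coord b x) (\<langle>b \<otimes> y\<rangle> - (\<Sum>b'\<in>Basis. fscale (coord b' y) \<langle>b \<otimes> b'\<rangle>))) \<in> ?S"
    by (intro free.subspace_sum[OF S] free.subspace_scale[OF S] 2)
  from free.subspace_add[OF S 1[of x y] this]
  show "Poly_Mapping.single p 1 - (\<Sum>i\<in>Basis \<times> Basis. fscale
      ((\<lambda>(x, y). coord (fst i) x * coord (snd i) y) p) \<langle>fst i \<otimes> snd i\<rangle>) \<in> ?S"
    by (simp add: p sum.cartesian_product case_prod_unfold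
        free.scale_right_diff_distrib sum_subtractf free.scale_sum_right)
next
  fix i :: "'b \<times> 'b"
  show "pairing (\<lambda>(x, y). coord (fst i) x * coord (snd i) y) (s - t) = 0"
    using assms[OF functional_coord functional_coord] by (simp add: eval2_def)
qed

lemma eq3I:
  assumes "\<And>f g h. functional scale f \<Longrightarrow> functional scale g \<Longrightarrow> functional scale h
    \<Longrightarrow> eval3 f g h s = eval3 f g h t"
  shows "eq3 scale s t"
  unfolding eq3_def
proof (rule mem_subspace_if_pairings_eq_0[OF free.subspace_span])
  let ?S = "free.span (rels3 scale)"
  note S = free.subspace_span[of "rels3 scale"]
  fix p :: "'b \<times> 'b \<times> 'b"
  obtain x y z where p: "p = (x, y, z)" by (cases p)
  have 1: "\<langle>x \<otimes> y \<otimes> z\<rangle> - (\<Sum>b\<in>Basis. fscale (coord b x) \<langle>b \<otimes> y \<otimes> z\<rangle>) \<in> ?S" for x y z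
    by (rule expand_in_basis[OF S]; simp add: free.span_base rels3_intros)
  have 2: "\<langle>x \<otimes> y \<otimes> z\<rangle> - (\<Sum>b\<in>Basis. fscale (coord b y) \<langle>x \<otimes> b \<otimes> z\<rangle>) \<in> ?S" for x y z
    by (rule expand_in_basis[OF S]; simp add: free.span_base rels3_intros)
  have 3: "\<langle>x \<otimes> y \<otimes> z\<rangle> - (\<Sum>b\<in>Basis. fscale (coord b z) \<langle>x \<otimes> y \<otimes> b\<rangle>) \<in> ?S" for x y z
    by (rule expand_in_basis[OF S]; simp add: free.span_base rels3_intros)
  have 23: "\<langle>x \<otimes> y \<otimes> z\<rangle> - (\<Sum>b'\<in>Basis. \<Sum>b''\<in>Basis.
      fscale (coord b' y * coord b'' z) \<langle>x \<otimes> b' \<otimes> b''\<rangle>) \<in> ?S" for x y z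
  proof -
    have "(\<Sum>b'\<in>Basis. fscale (coord b' y) (\<langle>x \<otimes> b' \<otimes> z\<rangle> -
        (\<Sum>b''\<in>Basis. fscale (coord b'' z) \<langle>x \<otimes> b' \<otimes> b''\<rangle>))) \<in> ?S"
      by (intro free.subspace_sum[OF S] free.subspace_scale[OF S] 3)
    from free.subspace_add[OF S 2[of x y z] this] show ?thesis
      by (simp add: free.scale_right_diff_distrib sum_subtractf free.scale_sum_right)
  qed
  have "(\<Sum>b\<in>Basis. fscale (coord b x) (\<langle>b \<otimes> y \<otimes> z\<rangle> - (\<Sum>b'\<in>Basis. \<Sum>b''\<in>Basis.
      fscale (coord b' y * coord b'' z) \<langle>b \<otimes> b' \<otimes> b''\<rangle>))) \<in> ?S"
    by (intro free.subspace_sum[OF S] free.subspace_scale[OF S] 23)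
  from free.subspace_add[OF S 1[of x y z] this]
  show "Poly_Mapping.single p 1 - (\<Sum>i\<in>Basis \<times> Basis \<times> Basis. fscale
      ((\<lambda>(x, y, z). coord (fst i) x * coord (fst (snd i)) y * coord (snd (snd i)) z) p)
      \<langle>fst i \<otimes> fst (snd i) \<otimes> snd (snd i)\<rangle>) \<in> ?S"
    by (simp add: p sum.cartesian_product case_prod_unfold
        free.scale_right_diff_distrib sum_subtractf free.scale_sum_right mult.assoc)
next
  fix i :: "'b \<times> 'b \<times> 'b"
  show "pairing (\<lambda>(x, y, z). coord (fst i) x * coord (fst (snd i)) y * coord (snd (snd i)) z)
      (s - t) = 0"
    using assms[OF functional_coord functional_coord functional_coord] by (simp add: eval3_def)
qed

end

section \<open>The tensor \<open>r\<close> as a map from the dual space\<close>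

locale symmetric_cdnybe_solution =
  novikov_dialgebra scale lprod rprod + finite_dimensional_vector_space scale Basis
  for scale :: "'k::field_char_0 \<Rightarrow> 'a::ab_group_add \<Rightarrow> 'a"
    and lprod :: "'a \<Rightarrow> 'a \<Rightarrow> 'a"  (infixl "\<stileturn>" 70)
    and rprod :: "'a \<Rightarrow> 'a \<Rightarrow> 'a"  (infixl "\<turnstile>" 70)
    and Basis :: "'a set" +
  fixes r :: "'a \<times> 'a \<Rightarrow>\<^sub>0 'k"
  assumes symmetric: "eq2 scale (\<tau> r) r"
    and cdnybe: "eq3 scale (cdnybe lprod rprod r) 0"
begin

definition sharp :: "('a \<Rightarrow> 'k) \<Rightarrow> 'a"  ("\<sharp>")
  where "\<sharp> f = (\<Sum>p\<in>Poly_Mapping.keys r. scale (Poly_Mapping.lookup r p * f (fst p)) (snd p))"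

lemma functional_sharp:
  assumes "functional scale g"
  shows "g (\<sharp> f) = eval2 f g r"
  by (simp add: sharp_def eval2_def pairing_def functional_simps[OF assms] case_prod_unfold mult.assoc)

lemma eval2_r_commute:
  assumes "functional scale f" "functional scale g"
  shows "eval2 f g r = eval2 g f r"
  using eval2_eq[OF assms symmetric] by (simp add: eval2_tau)

lemma functional_sharp_swap:
  assumes "functional scale f" "functional scale g"
  shows "f (\<sharp> g) = eval2 f g r"
  using assms by (simp add: functional_sharp eval2_r_commute)

text \<open>
  These evaluate sums over the terms of \<open>r\<close> in which either factor occurs inside a product: the
  functional without a product is moved into the product as \<open>\<sharp>\<close> of it.
\<close>

lemmas pairing_r_right = functional_sharp[unfolded eval2_def, symmetric]
lemmas pairing_r_left = functional_sharp_swap[unfolded eval2_def, symmetric]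

lemma functional_plus: "functional scale f \<Longrightarrow> functional scale g \<Longrightarrow> functional scale (\<lambda>x. f x + g x)"
  and functional_minus: "functional scale f \<Longrightarrow> functional scale g \<Longrightarrow> functional scale (\<lambda>x. f x - g x)"
  by (auto simp: Vector_Spaces.linear_iff algebra_simps)

lemma functional_product:
  assumes "functional scale f"
  shows "functional scale (\<lambda>x. f (a \<stileturn> x))" "functional scale (\<lambda>x. f (x \<stileturn> a))"
    "functional scale (\<lambda>x. f (a \<turnstile> x))" "functional scale (\<lambda>x. f (x \<turnstile> a))"
  using assms linear_lprod_left[of a] linear_lprod_right[of a]
    linear_rprod_left[of a] linear_rprod_right[of a]
  by (simp_all add: Vector_Spaces.linear_iff)

abbreviation star_prod :: "'a \<Rightarrow> 'a \<Rightarrow> 'a"  (infixl "\<star>" 70)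
  where "a \<star> b \<equiv> star lprod rprod a b"

lemma functional_star_apply:
  assumes "functional scale f"
  shows "f (a \<star> b) = f (a \<turnstile> b) + f (b \<stileturn> a) - f (a \<stileturn> b) - f (b \<turnstile> a)"
  by (simp add: star_def functional_simps[OF assms])

lemma functional_star:
  assumes "functional scale f"
  shows "functional scale (\<lambda>x. f (a \<star> x))" "functional scale (\<lambda>x. f (x \<star> a))"
  unfolding functional_star_apply[OF assms]
  by (intro functional_plus functional_minus functional_product assms)+

text \<open>
  The factor \<open>\<tau> r\<close> in \<open>\<delta>\<^sub>r\<close> is replaced by \<open>r\<close>, and \<open>f\<close> stays in the left slot, so that
  equal terms of different origin become syntactically equal.
\<close>

lemma eval2_delta:
  assumes "functional scale f" "functional scale g"
  shows "eval2 f g (delta_of lprod rprod r a)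
    = eval2 f (\<lambda>x. g (a \<star> x)) r + eval2 (\<lambda>x. f (a \<stileturn> x)) g r"
  using eval2_r_commute[OF functional_star(1)[OF assms(2)] assms(1)]
    eval2_r_commute[OF assms(2) functional_product(1)[OF assms(1)]]
  by (simp add: delta_of_def eval2_tensor_map eval2_tau L_def)

lemma eval2_Delta:
  assumes "functional scale f" "functional scale g"
  shows "eval2 f g (Delta_of lprod rprod r a)
    = eval2 (\<lambda>x. f (a \<stileturn> x) - f (a \<turnstile> x)) g r - eval2 f (\<lambda>x. g (a \<stileturn> x) + g (x \<turnstile> a)) r"
  by (simp add: Delta_of_def eval2_tensor_map L_def R_def functional_simps[OF assms(1)]
      functional_simps[OF assms(2)])

section \<open>The dual products\<close>

definition dual_lprod :: "('a \<Rightarrow> 'k) \<Rightarrow> ('a \<Rightarrow> 'k) \<Rightarrow> ('a \<Rightarrow> 'k)"  (infixl "\<stileturn>\<^sup>*" 70)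
  where "(f \<stileturn>\<^sup>* g) a = g (a \<star> \<sharp> f) + f (a \<stileturn> \<sharp> g)"

definition dual_rprod :: "('a \<Rightarrow> 'k) \<Rightarrow> ('a \<Rightarrow> 'k) \<Rightarrow> ('a \<Rightarrow> 'k)"  (infixl "\<turnstile>\<^sup>*" 70)
  where "(f \<turnstile>\<^sup>* g) a = f (a \<stileturn> \<sharp> g) - f (a \<turnstile> \<sharp> g) - g (a \<stileturn> \<sharp> f) - g (\<sharp> f \<turnstile> a)"

lemma functional_dual:
  assumes "functional scale f" "functional scale g"
  shows "functional scale (f \<stileturn>\<^sup>* g)" "functional scale (f \<turnstile>\<^sup>* g)"
  unfolding dual_lprod_def[abs_def] dual_rprod_def[abs_def]
  by (intro functional_plus functional_minus functional_product functional_star assms)+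

lemma eval2_delta_eq_dual:
  assumes "functional scale f" "functional scale g"
  shows "eval2 f g (delta_of lprod rprod r a) = (f \<stileturn>\<^sup>* g) a"
  using assms functional_sharp_swap[OF functional_product(1)[OF assms(1)] assms(2)]
    functional_sharp[OF functional_star(1)[OF assms(2)]]
  by (simp add: eval2_delta dual_lprod_def)

lemma eval2_Delta_eq_dual:
  assumes "functional scale f" "functional scale g"
  shows "eval2 f g (Delta_of lprod rprod r a) = (f \<turnstile>\<^sup>* g) a"
  using assms functional_sharp_swap[OF functional_product(1)[OF assms(1)] assms(2)]
    functional_sharp_swap[OF functional_product(3)[OF assms(1)] assms(2)]
    functional_sharp[OF functional_product(1)[OF assms(2)]]
    functional_sharp[OF functional_product(4)[OF assms(2)]]
  by (simp add: eval2_Delta dual_rprod_def eval2_fun_simps)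

text \<open>
  This is the value of \<open>N(r)\<close> at \<open>f \<otimes> g \<otimes> h\<close>. In each term of \<open>N(r)\<close> one tensor factor is a
  product with one factor from each copy of \<open>r\<close>; the other two tensor factors are the partners of
  these, and their functionals enter the product through \<open>\<sharp>\<close>.
\<close>

lemma cdnybe_functionals:
  assumes f: "functional scale f" and g: "functional scale g" and h: "functional scale h"
  shows "f (\<sharp> g \<turnstile> \<sharp> h) + g (\<sharp> f \<turnstile> \<sharp> h) - g (\<sharp> f \<stileturn> \<sharp> h)
    + h (\<sharp> g \<turnstile> \<sharp> f) + h (\<sharp> f \<stileturn> \<sharp> g) = 0"
proof -
  note pairing_linear = pairing_fun_add pairing_fun_diff pairing_fun_mult pairing_fun_mult_right
  \<comment> \<open>the sum over the second copy of \<open>r\<close>, for a fixed term \<open>x \<otimes> y\<close> of the first\<close>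
  have inner:
    "pairing (\<lambda>(x', y'). f (x \<turnstile> x') * h y') r = f (x \<turnstile> \<sharp> h)"
    "pairing (\<lambda>(x', y'). g (y \<turnstile> x') * h y') r = g (y \<turnstile> \<sharp> h)"
    "pairing (\<lambda>(x', y'). g (y \<stileturn> x') * h y') r = g (y \<stileturn> \<sharp> h)"
    "pairing (\<lambda>(x', y'). g x' * h (y' \<turnstile> y)) r = h (\<sharp> g \<turnstile> y)"
    "pairing (\<lambda>(x', y'). g x' * h (y \<stileturn> y')) r = h (y \<stileturn> \<sharp> g)" for x y
    by (fact pairing_r_left[OF functional_product(3)[OF f] h]
        pairing_r_left[OF functional_product(3)[OF g] h]
        pairing_r_left[OF functional_product(1)[OF g] h]
        pairing_r_right[OF functional_product(4)[OF h]]
        pairing_r_right[OF functional_product(1)[OF h]])+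
  have outer:
    "pairing (\<lambda>(x, y). f (x \<turnstile> \<sharp> h) * g y) r = f (\<sharp> g \<turnstile> \<sharp> h)"
    "pairing (\<lambda>(x, y). f x * g (y \<turnstile> \<sharp> h)) r = g (\<sharp> f \<turnstile> \<sharp> h)"
    "pairing (\<lambda>(x, y). f x * g (y \<stileturn> \<sharp> h)) r = g (\<sharp> f \<stileturn> \<sharp> h)"
    "pairing (\<lambda>(x, y). f x * h (\<sharp> g \<turnstile> y)) r = h (\<sharp> g \<turnstile> \<sharp> f)"
    "pairing (\<lambda>(x, y). f x * h (y \<stileturn> \<sharp> g)) r = h (\<sharp> f \<stileturn> \<sharp> g)"
    by (fact pairing_r_left[OF functional_product(4)[OF f] g]
        pairing_r_right[OF functional_product(4)[OF g]]
        pairing_r_right[OF functional_product(2)[OF g]]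
        pairing_r_right[OF functional_product(3)[OF h]]
        pairing_r_right[OF functional_product(2)[OF h]])+
  have "0 = eval3 f g h (cdnybe lprod rprod r)"
    using eval3_eq[OF f g h cdnybe] by simp
  also have "\<dots> = pairing (\<lambda>(x, y). pairing (\<lambda>(x', y').
      f (x \<turnstile> x') * h y' * g y + f x * (g (y \<turnstile> x') * h y') - f x * (g (y \<stileturn> x') * h y')
      + f x * (g x' * h (y' \<turnstile> y)) + f x * (g x' * h (y \<stileturn> y'))) r) r"
    by (simp add: eval3_def cdnybe_def case_prod_unfold functional_simps[OF g]
        functional_simps[OF h] algebra_simps)
  also have "\<dots> = pairing (\<lambda>(x, y).
      pairing (\<lambda>(x', y'). f (x \<turnstile> x') * h y') r * g y
      + f x * pairing (\<lambda>(x', y'). g (y \<turnstile> x') * h y') r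
      - f x * pairing (\<lambda>(x', y'). g (y \<stileturn> x') * h y') r
      + f x * pairing (\<lambda>(x', y'). g x' * h (y' \<turnstile> y)) r
      + f x * pairing (\<lambda>(x', y'). g x' * h (y \<stileturn> y')) r) r"
    by (simp only: case_prod_unfold pairing_linear)
  also have "\<dots> = f (\<sharp> g \<turnstile> \<sharp> h) + g (\<sharp> f \<turnstile> \<sharp> h) - g (\<sharp> f \<stileturn> \<sharp> h)
    + h (\<sharp> g \<turnstile> \<sharp> f) + h (\<sharp> f \<stileturn> \<sharp> g)"
    unfolding inner using outer by (simp add: case_prod_unfold pairing_linear)
  finally show ?thesis by simp
qed

text \<open>
  A functional \<open>h\<close> moves across \<open>\<sharp>\<close> by symmetry: \<open>h (\<sharp> (f \<stileturn>\<^sup>* g)) = (f \<stileturn>\<^sup>* g) (\<sharp> h)\<close>.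
  The right-hand side expands to \<open>h (\<sharp> f \<stileturn> \<sharp> g)\<close> plus the difference of the values of \<open>N(r)\<close>
  at \<open>f \<otimes> h \<otimes> g\<close> and \<open>h \<otimes> f \<otimes> g\<close>.
\<close>

lemma sharp_dual_lprod:
  assumes f: "functional scale f" and g: "functional scale g"
  shows "\<sharp> (f \<stileturn>\<^sup>* g) = \<sharp> f \<stileturn> \<sharp> g"
proof (rule functionals_separate_points)
  fix h assume h: "functional scale h"
  have "h (\<sharp> (f \<stileturn>\<^sup>* g)) = (f \<stileturn>\<^sup>* g) (\<sharp> h)"
    by (simp only: functional_sharp[OF h] functional_sharp_swap[OF functional_dual(1)[OF f g] h])
  also have "(f \<stileturn>\<^sup>* g) (\<sharp> h) = h (\<sharp> f \<stileturn> \<sharp> g)"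
  proof -
    have "(f \<stileturn>\<^sup>* g) (\<sharp> h) = h (\<sharp> f \<stileturn> \<sharp> g)
      + (f (\<sharp> h \<turnstile> \<sharp> g) + h (\<sharp> f \<turnstile> \<sharp> g) - h (\<sharp> f \<stileturn> \<sharp> g)
        + g (\<sharp> h \<turnstile> \<sharp> f) + g (\<sharp> f \<stileturn> \<sharp> h))
      - (h (\<sharp> f \<turnstile> \<sharp> g) + f (\<sharp> h \<turnstile> \<sharp> g) - f (\<sharp> h \<stileturn> \<sharp> g)
        + g (\<sharp> f \<turnstile> \<sharp> h) + g (\<sharp> h \<stileturn> \<sharp> f))"
      by (simp add: dual_lprod_def functional_star_apply[OF g])
    then show ?thesis
      by (simp only: cdnybe_functionals[OF f h g] cdnybe_functionals[OF h f g] add_0_right diff_zero)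
  qed
  finally show "h (\<sharp> (f \<stileturn>\<^sup>* g)) = h (\<sharp> f \<stileturn> \<sharp> g)" .
qed

text \<open>Here the single value of \<open>N(r)\<close> at \<open>h \<otimes> f \<otimes> g\<close> suffices.\<close>

lemma sharp_dual_rprod:
  assumes f: "functional scale f" and g: "functional scale g"
  shows "\<sharp> (f \<turnstile>\<^sup>* g) = \<sharp> f \<turnstile> \<sharp> g"
proof (rule functionals_separate_points)
  fix h assume h: "functional scale h"
  have "h (\<sharp> (f \<turnstile>\<^sup>* g)) = (f \<turnstile>\<^sup>* g) (\<sharp> h)"
    by (simp only: functional_sharp[OF h] functional_sharp_swap[OF functional_dual(2)[OF f g] h])
  also have "\<dots> = h (\<sharp> f \<turnstile> \<sharp> g)"
  proof -
    have "(f \<turnstile>\<^sup>* g) (\<sharp> h) = h (\<sharp> f \<turnstile> \<sharp> g)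
      - (h (\<sharp> f \<turnstile> \<sharp> g) + f (\<sharp> h \<turnstile> \<sharp> g) - f (\<sharp> h \<stileturn> \<sharp> g)
        + g (\<sharp> f \<turnstile> \<sharp> h) + g (\<sharp> h \<stileturn> \<sharp> f))"
      by (simp add: dual_rprod_def)
    then show ?thesis
      by (simp only: cdnybe_functionals[OF h f g] diff_zero)
  qed
  finally show "h (\<sharp> (f \<turnstile>\<^sup>* g)) = h (\<sharp> f \<turnstile> \<sharp> g)" .
qed

section \<open>The co-dialgebra axioms\<close>

lemma product_linear:
  "(x + y) \<stileturn> z = x \<stileturn> z + y \<stileturn> z" "(x - y) \<stileturn> z = x \<stileturn> z - y \<stileturn> z" "(- x) \<stileturn> z = - (x \<stileturn> z)"
  "x \<stileturn> (y + z) = x \<stileturn> y + x \<stileturn> z" "x \<stileturn> (y - z) = x \<stileturn> y - x \<stileturn> z" "x \<stileturn> (- y) = - (x \<stileturn> y)"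
  "(x + y) \<turnstile> z = x \<turnstile> z + y \<turnstile> z" "(x - y) \<turnstile> z = x \<turnstile> z - y \<turnstile> z" "(- x) \<turnstile> z = - (x \<turnstile> z)"
  "x \<turnstile> (y + z) = x \<turnstile> y + x \<turnstile> z" "x \<turnstile> (y - z) = x \<turnstile> y - x \<turnstile> z" "x \<turnstile> (- y) = - (x \<turnstile> y)"
  by (fact
      module_hom.add[OF module_hom_linearI[OF linear_lprod_left]]
      module_hom.diff[OF module_hom_linearI[OF linear_lprod_left]]
      module_hom.neg[OF module_hom_linearI[OF linear_lprod_left]]
      module_hom.add[OF module_hom_linearI[OF linear_lprod_right]]
      module_hom.diff[OF module_hom_linearI[OF linear_lprod_right]]
      module_hom.neg[OF module_hom_linearI[OF linear_lprod_right]]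
      module_hom.add[OF module_hom_linearI[OF linear_rprod_left]]
      module_hom.diff[OF module_hom_linearI[OF linear_rprod_left]]
      module_hom.neg[OF module_hom_linearI[OF linear_rprod_left]]
      module_hom.add[OF module_hom_linearI[OF linear_rprod_right]]
      module_hom.diff[OF module_hom_linearI[OF linear_rprod_right]]
      module_hom.neg[OF module_hom_linearI[OF linear_rprod_right]])+

text \<open>
  The axioms as rewrite rules for products of three elements. The words that remain are
  \<open>(x \<turnstile> y) \<turnstile> z\<close>, \<open>x \<stileturn> (y \<turnstile> z)\<close>, \<open>(x \<stileturn> y) \<stileturn> z\<close> up to exchange of \<open>y\<close> and \<open>z\<close>, and
  \<open>x \<turnstile> (y \<turnstile> z)\<close>. For the last kind, \<open>rprod_rprod\<close> exchanges \<open>x\<close> and \<open>y\<close>; this rule would loop, so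
  it is used only in instances that bring the two elements into a fixed order.
\<close>

lemma rprod_lprod: "b \<turnstile> (a \<stileturn> c) = (b \<turnstile> c) \<turnstile> a - (a \<stileturn> b) \<stileturn> c + a \<stileturn> (b \<turnstile> c)"
  using dialgebra5[of a b c] by (simp add: dialgebra1 dialgebra3 algebra_simps)

lemma rprod_rprod: "a \<turnstile> (b \<turnstile> c) = b \<turnstile> (a \<turnstile> c) + (a \<turnstile> b) \<turnstile> c - (b \<turnstile> a) \<turnstile> c"
  using dialgebra6[of a b c] by (simp add: algebra_simps)

lemmas normalize_products =
  dialgebra1 dialgebra2[symmetric] dialgebra3 dialgebra4 rprod_lprod product_linear

context
  fixes f g h :: "'a \<Rightarrow> 'k" and a :: 'a
  assumes f: "functional scale f" and g: "functional scale g" and h: "functional scale h"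
begin

text \<open>
  Expanding by these rules, each dual axiom at \<open>a\<close> becomes an identity between values of \<open>f\<close>, \<open>g\<close>
  and \<open>h\<close> at products of \<open>a\<close> with two of \<open>\<sharp> f\<close>, \<open>\<sharp> g\<close>, \<open>\<sharp> h\<close>.
  The instances of \<open>rprod_rprod\<close> order the elements as \<open>a\<close>, \<open>\<sharp> f\<close>, \<open>\<sharp> g\<close>, \<open>\<sharp> h\<close>.
\<close>

lemmas dual_simps = dual_lprod_def dual_rprod_def star_def
  sharp_dual_lprod[OF f g] sharp_dual_lprod[OF g f] sharp_dual_lprod[OF f h] sharp_dual_lprod[OF g h]
  sharp_dual_rprod[OF f g] sharp_dual_rprod[OF g f] sharp_dual_rprod[OF f h] sharp_dual_rprod[OF g h]
  functional_simps[OF f] functional_simps[OF g] functional_simps[OF h]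
  normalize_products rprod_rprod[of _ a]
  rprod_rprod[of "\<sharp> g" "\<sharp> f"] rprod_rprod[of "\<sharp> h" "\<sharp> f"] rprod_rprod[of "\<sharp> h" "\<sharp> g"]

lemma dual_dialgebra:
  "((f \<turnstile>\<^sup>* g) \<stileturn>\<^sup>* h) a = ((f \<turnstile>\<^sup>* h) \<turnstile>\<^sup>* g) a"
  "((f \<turnstile>\<^sup>* h) \<turnstile>\<^sup>* g) a = ((f \<stileturn>\<^sup>* h) \<turnstile>\<^sup>* g) a"
  "(f \<stileturn>\<^sup>* (g \<stileturn>\<^sup>* h)) a = (f \<stileturn>\<^sup>* (g \<turnstile>\<^sup>* h)) a"
  "((f \<stileturn>\<^sup>* g) \<stileturn>\<^sup>* h) a = ((f \<stileturn>\<^sup>* h) \<stileturn>\<^sup>* g) a"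
  "((f \<stileturn>\<^sup>* g) \<stileturn>\<^sup>* h) a - (f \<stileturn>\<^sup>* (g \<stileturn>\<^sup>* h)) a
    = ((g \<turnstile>\<^sup>* f) \<stileturn>\<^sup>* h) a - (g \<turnstile>\<^sup>* (f \<stileturn>\<^sup>* h)) a"
  "((f \<turnstile>\<^sup>* g) \<turnstile>\<^sup>* h) a - (f \<turnstile>\<^sup>* (g \<turnstile>\<^sup>* h)) a
    = ((g \<turnstile>\<^sup>* f) \<turnstile>\<^sup>* h) a - (g \<turnstile>\<^sup>* (f \<turnstile>\<^sup>* h)) a"
  by (simp_all add: dual_simps)

end

lemma novikov_codialgebra_of_r:
  "novikov_codialgebra scale (delta_of lprod rprod r) (Delta_of lprod rprod r)"
proof -
  let ?\<delta> = "delta_of lprod rprod r" and ?\<Delta> = "Delta_of lprod rprod r"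
  have eval_simps:
    "eval2 f g (?\<delta> a) = (f \<stileturn>\<^sup>* g) a"
    "eval2 f g (?\<Delta> a) = (f \<turnstile>\<^sup>* g) a"
    "eval3 f g h (cop_id ?\<delta> t) = eval2 (f \<stileturn>\<^sup>* g) h t"
    "eval3 f g h (cop_id ?\<Delta> t) = eval2 (f \<turnstile>\<^sup>* g) h t"
    "eval3 f g h (id_cop ?\<delta> t) = eval2 f (g \<stileturn>\<^sup>* h) t"
    "eval3 f g h (id_cop ?\<Delta> t) = eval2 f (g \<turnstile>\<^sup>* h) t"
    if "functional scale f" "functional scale g" "functional scale h" for f g h a t
    using that by (simp_all add: eval2_delta_eq_dual eval2_Delta_eq_dual eval3_cop_id eval3_id_cop)
  show ?thesis
  proof unfold_locales
    fix a b :: 'a and k :: 'k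
    show "eq2 scale (?\<delta> (a + b)) (?\<delta> a + ?\<delta> b)" "eq2 scale (?\<delta> (scale k a)) (fscale k (?\<delta> a))"
      "eq2 scale (?\<Delta> (a + b)) (?\<Delta> a + ?\<Delta> b)" "eq2 scale (?\<Delta> (scale k a)) (fscale k (?\<Delta> a))"
      by (rule eq2I; simp add: eval2_delta_eq_dual eval2_Delta_eq_dual functional_simps[OF functional_dual(1)]
          functional_simps[OF functional_dual(2)])+
    show "eq3 scale (cop_id ?\<delta> (?\<delta> a)) (\<tau>\<^sub>2\<^sub>3 (cop_id ?\<delta> (?\<delta> a)))"
      by (rule eq3I) (simp add: eval_simps eval3_tau23 functional_dual dual_dialgebra(4))
    show "eq3 scale (cop_id ?\<Delta> (?\<delta> a)) (\<tau>\<^sub>2\<^sub>3 (cop_id ?\<Delta> (?\<Delta> a)))"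
      by (rule eq3I) (simp add: eval_simps eval3_tau23 functional_dual dual_dialgebra(1))
    show "eq3 scale (\<tau>\<^sub>2\<^sub>3 (cop_id ?\<Delta> (?\<Delta> a))) (\<tau>\<^sub>2\<^sub>3 (cop_id ?\<delta> (?\<Delta> a)))"
      by (rule eq3I) (simp add: eval_simps eval3_tau23 functional_dual dual_dialgebra(2))
    show "eq3 scale (id_cop ?\<delta> (?\<delta> a)) (id_cop ?\<Delta> (?\<delta> a))"
      by (rule eq3I) (simp add: eval_simps functional_dual dual_dialgebra(3))
    show "eq3 scale ((cop_id ?\<delta> - id_cop ?\<delta>) (?\<delta> a))
      (\<tau>\<^sub>1\<^sub>2 (cop_id ?\<Delta> (?\<delta> a) - id_cop ?\<delta> (?\<Delta> a)))"
      by (rule eq3I) (simp add: eval_simps eval3_tau12 functional_dual dual_dialgebra(5))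
    show "eq3 scale ((cop_id ?\<Delta> - id_cop ?\<Delta>) (?\<Delta> a))
      (\<tau>\<^sub>1\<^sub>2 ((cop_id ?\<Delta> - id_cop ?\<Delta>) (?\<Delta> a)))"
      by (rule eq3I) (simp add: eval_simps eval3_tau12 functional_dual dual_dialgebra(6))
  qed
qed

section \<open>The compatibility conditions\<close>

lemma eval2_tau_delta:
  assumes "functional scale f" "functional scale g"
  shows "eval2 f g (\<tau> (delta_of lprod rprod r a))
    = eval2 (\<lambda>x. f (a \<star> x)) g r + eval2 f (\<lambda>x. g (a \<stileturn> x)) r"
  using eval2_r_commute[OF functional_star(1)[OF assms(1)] assms(2)]
    eval2_r_commute[OF assms(1) functional_product(1)[OF assms(2)]] assms
  by (simp add: eval2_tau eval2_delta)

lemma eval2_tau_Delta: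
  assumes "functional scale f" "functional scale g"
  shows "eval2 f g (\<tau> (Delta_of lprod rprod r a))
    = eval2 f (\<lambda>x. g (a \<stileturn> x) - g (a \<turnstile> x)) r - eval2 (\<lambda>x. f (a \<stileturn> x) + f (x \<turnstile> a)) g r"
  using eval2_r_commute[OF functional_product(1)[OF assms(1)] assms(2)]
    eval2_r_commute[OF functional_product(4)[OF assms(1)] assms(2)]
    eval2_r_commute[OF assms(1) functional_product(1)[OF assms(2)]]
    eval2_r_commute[OF assms(1) functional_product(3)[OF assms(2)]] assms
  by (simp add: eval2_tau eval2_Delta eval2_fun_simps)

lemma tau_linear: "\<tau> (s + t) = \<tau> s + \<tau> t" "\<tau> (s - t) = \<tau> s - \<tau> t"
  by (simp_all add: tau_def lext_add lext_diff)

text \<open>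
  Expanding by these rules, a compatibility condition at \<open>f \<otimes> g\<close> becomes a linear relation between
  terms \<open>eval2 (\<lambda>x. f (u x)) (\<lambda>x. g (v x)) r\<close> with \<open>u x\<close> and \<open>v x\<close> in normal form.
\<close>

context
  fixes f g :: "'a \<Rightarrow> 'k"
  assumes f: "functional scale f" and g: "functional scale g"
begin

lemmas expand_compatibility =
  eval2_tensor_map tau_linear eval2_delta eval2_Delta eval2_tau_delta eval2_tau_Delta eval2_fun_simps
  L_def R_def star_def functional_simps[OF f] functional_simps[OF g]
  functional_product[OF f] functional_product[OF g] functional_plus functional_minus
  f g normalize_products

end

lemma novikov_bi_dialgebra_of_r:
  "novikov_bi_dialgebra scale lprod rprod (delta_of lprod rprod r) (Delta_of lprod rprod r)"
proof -
  interpret novikov_codialgebra scale "delta_of lprod rprod r" "Delta_of lprod rprod r"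
    by (fact novikov_codialgebra_of_r)
  \<comment> \<open>The functionals are composed with products of \<open>a\<close>, \<open>b\<close> and a bound variable. The two
    instances of \<open>rprod_rprod\<close> order these three: \<open>a\<close> first, the bound variable last.\<close>
  show ?thesis
    apply (unfold_locales; rule eq2I)
    subgoal premises fg for a b
      by (simp add: expand_compatibility[OF fg] rprod_rprod[of _ a] rprod_rprod[of _ b a])
    subgoal premises fg for a b
      by (simp add: expand_compatibility[OF fg] rprod_rprod[of _ a] rprod_rprod[of _ b a])
    subgoal premises fg for a b
      by (simp add: expand_compatibility[OF fg] rprod_rprod[of _ a] rprod_rprod[of _ b a])
    subgoal premises fg for a b
      by (simp add: expand_compatibility[OF fg] rprod_rprod[of _ a] rprod_rprod[of _ b a])
    subgoal premises fg for a b
      by (simp add: expand_compatibility[OF fg] rprod_rprod[of _ a] rprod_rprod[of _ b a])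
    subgoal premises fg for a b
      by (simp add: expand_compatibility[OF fg] rprod_rprod[of _ a] rprod_rprod[of _ b a])
    subgoal premises fg for a b
      by (simp add: expand_compatibility[OF fg] rprod_rprod[of _ a] rprod_rprod[of _ b a])
    subgoal premises fg for a b
      by (simp add: expand_compatibility[OF fg] rprod_rprod[of _ a] rprod_rprod[of _ b a])
    subgoal premises fg for a b
      by (simp add: expand_compatibility[OF fg] rprod_rprod[of _ a] rprod_rprod[of _ b a])
    done
qed

end

theorem corollary5p7:
  fixes scale :: "'k::field_char_0 \<Rightarrow> 'a::ab_group_add \<Rightarrow> 'a"
    and lprod rprod :: "'a \<Rightarrow> 'a \<Rightarrow> 'a"
    and r :: "'a \<times> 'a \<Rightarrow>\<^sub>0 'k"
  assumes "\<exists>B. finite_dimensional_vector_space scale B"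
    and "novikov_dialgebra scale lprod rprod"
    and "eq2 scale (\<tau> r) r"
    and "eq3 scale (cdnybe lprod rprod r) 0"
  shows "novikov_bi_dialgebra scale lprod rprod (delta_of lprod rprod r) (Delta_of lprod rprod r)"
proof -
  from assms(1) obtain B where "finite_dimensional_vector_space scale B" ..
  then interpret symmetric_cdnybe_solution scale lprod rprod B r
    using assms(2-4) by (simp add: symmetric_cdnybe_solution_def symmetric_cdnybe_solution_axioms_def)
  show ?thesis by (fact novikov_bi_dialgebra_of_r)
qed

end
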